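(* For every $n\ge1$, the number of ascent sequences of length $n$ avoiding the pattern $012$ is $2^{n-1}$, and for every $k\ge0$ the number of such sequences with exactly $k$ ascents is $\binom{n}{2k}$.
   Context: An ascent sequence is a finite sequence $x_1x_2\ldots x_n$ of nonnegative integers with $x_1=0$ and $x_i\le \operatorname{asc}(x_1\ldots x_{i-1})+1$ for all $1<i\le n$, where $\operatorname{asc}(y_1\ldots y_k)$, the number of ascents, is the number of indices $j$ with $y_j<y_{j+1}$. A pattern is a finite word over the nonnegative integers (repetitions allowed). An occurrence of a pattern $p=p_1\ldots p_k$ in a sequence $x_1\ldots x_n$ is a subsequence $x_{i_1}\ldots x_{i_k}$ with $i_1<\cdots<i_k$ such that for all $a,b$: $x_{i_a}<x_{i_b}$ iff $p_a<p_b$, and $x_{i_a}=x_{i_b}$ iff $p_a=p_b$. A sequence avoids $p$ if it has no occurrence of $p$. Thus avoiding $012$ means having no subsequence $x_{i_1}<x_{i_2}<x_{i_3}$ with $i_1<i_2<i_3$. *)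

theory Defs
  imports Complex_Main
begin

text \<open>Sequences and patterns are lists of natural numbers, indexed from 0: the entry
  $x_i$ of the usual notation is \<open>xs ! (i - 1)\<close>.\<close>

definition asc :: "nat list \<Rightarrow> nat" where
  "asc xs = card {j. Suc j < length xs \<and> xs ! j < xs ! Suc j}"

text \<open>The condition $x_1 = 0$ presupposes a first entry, so ascent sequences are nonempty.
  \<open>take i xs\<close> is the prefix of all entries strictly before position \<open>i\<close>.\<close>

definition ascent_sequence :: "nat list \<Rightarrow> bool" where
  "ascent_sequence xs \<longleftrightarrow>
     xs \<noteq> [] \<and> xs ! 0 = 0 \<and>
     (\<forall>i. 0 < i \<and> i < length xs \<longrightarrow> xs ! i \<le> asc (take i xs) + 1)"

text \<open>An occurrence is represented by the list \<open>idx\<close> of its positions.\<close>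

definition occurrence :: "nat list \<Rightarrow> nat list \<Rightarrow> nat list \<Rightarrow> bool" where
  "occurrence p xs idx \<longleftrightarrow>
     length idx = length p \<and>
     sorted_wrt (<) idx \<and>
     (\<forall>i \<in> set idx. i < length xs) \<and>
     (\<forall>a < length p. \<forall>b < length p.
        (xs ! (idx ! a) < xs ! (idx ! b) \<longleftrightarrow> p ! a < p ! b) \<and>
        (xs ! (idx ! a) = xs ! (idx ! b) \<longleftrightarrow> p ! a = p ! b))"

definition avoids :: "nat list \<Rightarrow> nat list \<Rightarrow> bool" where
  "avoids xs p \<longleftrightarrow> \<not> (\<exists>idx. occurrence p xs idx)"

definition avoiding_ascent_sequences :: "nat list \<Rightarrow> nat \<Rightarrow> nat list set" where
  "avoiding_ascent_sequences p n = {xs. length xs = n \<and> ascent_sequence xs \<and> avoids xs p}"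

end

theory Submission
  imports Defs
begin

text \<open>An ascent sequence avoiding $012$ has only entries $0$ and $1$: the first entry exceeding $1$
  would need an earlier ascent, and together with that ascent it would form a $012$. Conversely
  every binary word starting with $0$ qualifies. Counting the words by ascents while deleting the
  first letter gives a recursion which is Pascal's rule in disguise.\<close>

lemma asc_singleton: "asc [x] = 0"
  by (simp add: asc_def)

lemma asc_Cons_Cons: "asc (x # y # w) = (if x < y then Suc (asc (y # w)) else asc (y # w))"
proof -
  define A where "A = {j. Suc j < length (y # w) \<and> (y # w) ! j < (y # w) ! Suc j}"
  have fin: "finite A"
    by (rule finite_subset [of _ "{..<length (y # w)}"]) (auto simp: A_def)
  \<comment> \<open>Index 0 accounts for the pair \<open>x\<close>, \<open>y\<close>; every other
    ascent is one of \<open>y # w\<close> with its index shifted by one.\<close>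
  have "{j. Suc j < length (x # y # w) \<and> (x # y # w) ! j < (x # y # w) ! Suc j}
      = (if x < y then {0} else {}) \<union> Suc ` A" (is "?L = ?R")
  proof (rule set_eqI)
    show "j \<in> ?L \<longleftrightarrow> j \<in> ?R" for j
      by (cases j) (auto simp: A_def)
  qed
  then have "asc (x # y # w) = card ((if x < y then {0} else {}) \<union> Suc ` A)"
    by (simp add: asc_def)
  moreover have "asc (y # w) = card A"
    by (simp add: asc_def A_def)
  ultimately show ?thesis
    using fin by (simp add: card_image)
qed

text \<open>Two consecutive strict comparisons determine all others by transitivity, so the
  equivalences in \<open>occurrence\<close> collapse to a chain.\<close>

lemma occurrence_012_iff:
  "occurrence [0, 1, 2] xs idx \<longleftrightarrow>
     (\<exists>a b c. idx = [a, b, c] \<and> a < b \<and> b < c \<and> c < length xs \<and> xs ! a < xs ! b \<and> xs ! b < xs ! c)"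
  by (auto simp: occurrence_def length_Suc_conv numeral_3_eq_3 numeral_2_eq_2 less_Suc_eq
      all_conj_distrib)

lemma ascent_sequence_avoids_012_iff:
  "ascent_sequence xs \<and> avoids xs [0, 1, 2] \<longleftrightarrow> xs \<noteq> [] \<and> hd xs = 0 \<and> set xs \<subseteq> {0, 1}"
proof
  assume *: "ascent_sequence xs \<and> avoids xs [0, 1, 2]"
  then have ne: "xs \<noteq> []" "xs ! 0 = 0"
    by (auto simp: ascent_sequence_def)
  have "xs ! i \<le> 1" if "i < length xs" for i
    using that
  proof (induction i rule: less_induct)
    case (less i)
    show ?case
    proof (rule ccontr)
      assume big: "\<not> xs ! i \<le> 1"
      with ne have "i > 0"
        by (cases i) auto
      \<comment> \<open>With no ascent before position \<open>i\<close>, the bound on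
        \<open>xs ! i\<close> would be 1.\<close>
      then have "asc (take i xs) \<noteq> 0"
        using * big less.prems by (force simp: ascent_sequence_def)
      then have "{j. Suc j < length (take i xs) \<and> take i xs ! j < take i xs ! Suc j} \<noteq> {}"
        unfolding asc_def by (metis card.empty)
      then obtain j where j: "Suc j < i" "xs ! j < xs ! Suc j"
        by auto
      \<comment> \<open>By induction the top of the earlier ascent is at most 1, while
        \<open>xs ! i\<close> is at least 2.\<close>
      moreover have "xs ! Suc j < xs ! i"
        using less.IH [of "Suc j"] j less.prems big by linarith
      ultimately have "occurrence [0, 1, 2] xs [j, Suc j, i]"
        unfolding occurrence_012_iff using less.prems by blast
      with * show False
        by (auto simp: avoids_def)
    qed
  qed
  then have "\<forall>x \<in> set xs. x \<le> 1"
    by (auto simp: in_set_conv_nth)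
  with ne show "xs \<noteq> [] \<and> hd xs = 0 \<and> set xs \<subseteq> {0, 1}"
    by (force simp: hd_conv_nth)
next
  assume *: "xs \<noteq> [] \<and> hd xs = 0 \<and> set xs \<subseteq> {0, 1}"
  have le: "xs ! i \<le> 1" if "i < length xs" for i
    using * nth_mem [OF that] by fastforce
  \<comment> \<open>The bound \<open>asc (take i xs) + 1\<close> is never below 1, so binary entries
    cannot violate it.\<close>
  then have "ascent_sequence xs"
    using * by (auto simp: ascent_sequence_def hd_conv_nth intro: le_trans [OF le])
  \<comment> \<open>The last entry of an occurrence would be at least 2.\<close>
  moreover have "avoids xs [0, 1, 2]"
    unfolding avoids_def occurrence_012_iff by (auto dest!: le)
  ultimately show "ascent_sequence xs \<and> avoids xs [0, 1, 2]" ..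
qed

definition binary_words :: "nat \<Rightarrow> nat list set" where
  "binary_words n = {w. set w \<subseteq> {0, 1} \<and> length w = n}"

lemma finite_binary_words: "finite (binary_words n)"
  by (simp add: binary_words_def finite_lists_length_eq)

lemma card_binary_words: "card (binary_words n) = 2 ^ n"
  by (simp add: binary_words_def card_lists_length_eq numeral_2_eq_2)

lemma binary_words_0: "{w \<in> binary_words 0. P w} = (if P [] then {[]} else {})"
  by (auto simp: binary_words_def)

lemma binary_words_Suc: "binary_words (Suc n) = Cons 0 ` binary_words n \<union> Cons 1 ` binary_words n"
  by (auto simp: binary_words_def length_Suc_conv)

text \<open>Splitting by first letter, for arbitrary \<open>P\<close> so that a letter kept in front
  of the word can be part of the condition.\<close>

lemma card_binary_words_Suc:
  "card {w \<in> binary_words (Suc n). P w}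
     = card {w \<in> binary_words n. P (0 # w)} + card {w \<in> binary_words n. P (1 # w)}"
proof -
  have "{w \<in> binary_words (Suc n). P w}
      = Cons 0 ` {w \<in> binary_words n. P (0 # w)} \<union> Cons 1 ` {w \<in> binary_words n. P (1 # w)}"
    by (auto simp: binary_words_Suc)
  then show ?thesis
    using card_Un_disjoint [of "Cons 0 ` {w \<in> binary_words n. P (0 # w)}"
        "Cons 1 ` {w \<in> binary_words n. P (1 # w)}"]
    by (auto simp: card_image finite_binary_words)
qed

text \<open>Whether the next letter creates an ascent depends on the letter before it, so both
  leading letters are treated in one induction. They supply the even and the odd lower indices, and
  each recursion adds two adjacent binomials of one row.\<close>

lemma card_binary_words_asc:
  "card {w \<in> binary_words n. asc (0 # w) = k} = Suc n choose (2 * k)"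
  "card {w \<in> binary_words n. asc (1 # w) = k} = Suc n choose Suc (2 * k)"
proof (induction n arbitrary: k)
  case 0
  {
    case (1 k)
    show ?case
      by (cases k) (simp_all add: binary_words_0 asc_singleton)
  next
    case (2 k)
    show ?case
      by (cases k) (simp_all add: binary_words_0 asc_singleton)
  }
next
  case (Suc n)
  {
    case (1 k)
    show ?case
      \<comment> \<open>The prefix 0, 1 is already an ascent: it contributes nothing for
        \<open>k = 0\<close>, and otherwise leaves \<open>k - 1\<close> ascents, which gives the
        lower index \<open>2 * k - 1\<close>.\<close>
      by (cases k) (simp_all add: card_binary_words_Suc asc_Cons_Cons Suc.IH [simplified])
  next
    case (2 k)
    show ?case
      by (simp add: card_binary_words_Suc asc_Cons_Cons Suc.IH [simplified])
  }
qed

text \<open>Only the first letter is forced; the \<open>m\<close> free letters explain the exponent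
  \<open>n - 1\<close>.\<close>

lemma avoiding_ascent_sequences_012:
  "avoiding_ascent_sequences [0, 1, 2] (Suc m) = Cons 0 ` binary_words m"
  unfolding avoiding_ascent_sequences_def ascent_sequence_avoids_012_iff
  by (auto simp: binary_words_def length_Suc_conv)

theorem theorem2p2:
  fixes n :: nat
  assumes "n \<ge> 1"
  shows "card (avoiding_ascent_sequences [0, 1, 2] n) = 2 ^ (n - 1) \<and>
         (\<forall>k::nat. card {xs \<in> avoiding_ascent_sequences [0, 1, 2] n. asc xs = k} = n choose (2 * k))"
proof -
  obtain m where n: "n = Suc m"
    using assms by (cases n) auto
  have "{xs \<in> avoiding_ascent_sequences [0, 1, 2] n. asc xs = k}
      = Cons 0 ` {w \<in> binary_words m. asc (0 # w) = k}" for k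
    unfolding n avoiding_ascent_sequences_012 by auto
  then have "card {xs \<in> avoiding_ascent_sequences [0, 1, 2] n. asc xs = k} = n choose (2 * k)" for k
    by (simp add: card_image card_binary_words_asc n del: binomial_Suc_Suc)
  moreover have "card (avoiding_ascent_sequences [0, 1, 2] n) = 2 ^ (n - 1)"
    unfolding n avoiding_ascent_sequences_012 by (simp add: card_image card_binary_words)
  ultimately show ?thesis
    by blast
qed

end
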